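(* For every integer $k\geq 1$, there exists an infinite family of $2k$-regular simple graphs each of which is $(2k+1)$-ordered hamiltonian.
   Context: All graphs are finite and simple. A simple graph $G$ is $r$-ordered hamiltonian if, for every sequence $v_1, v_2, \ldots, v_r$ of $r$ distinct vertices of $G$, there exists a hamiltonian cycle of $G$ (a cycle containing every vertex of $G$) that contains $v_1, \ldots, v_r$ in this (cyclic) order. *)

theory Defs
  imports "Graph_Theory.Graph_Theory" "HOL-Library.Sublist"
begin

text \<open>
  Finite simple graphs are the \<^locale>\<open>pair_graph\<close>s: finite, loop-free, symmetric digraphs
  without parallel arcs, an undirected edge \<open>uv\<close> being the pair of arcs \<open>(u, v)\<close>, \<open>(v, u)\<close>.
  By symmetry the degree of a vertex is its out-degree.
\<close>

definition regular_graph :: "nat \<Rightarrow> 'a pair_pre_digraph \<Rightarrow> bool" where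
  "regular_graph d G \<longleftrightarrow> (\<forall>v \<in> pverts G. out_degree (with_proj G) v = d)"

text \<open>
  The library's cycles are nonempty closed arc walks without repeated vertices; in a symmetric
  digraph these include \<open>[(u, v), (v, u)]\<close>, which is not a cycle of the undirected graph, hence the
  bound on the length. The vertices of a cycle \<open>p\<close>, in order of traversal, are \<open>map fst p\<close>.
\<close>

definition hamiltonian_cycle :: "'a pair_pre_digraph \<Rightarrow> ('a \<times> 'a) awalk \<Rightarrow> bool" where
  "hamiltonian_cycle G p \<longleftrightarrow>
     pre_digraph.cycle (with_proj G) p \<and> 3 \<le> length p \<and> set (map fst p) = pverts G"

definition in_cyclic_order :: "'a list \<Rightarrow> 'a list \<Rightarrow> bool" where
  "in_cyclic_order vs cs \<longleftrightarrow> (\<exists>n. subseq vs (rotate n cs))"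

text \<open>
  An undirected cycle corresponds to arc cycles in both directions of traversal, so the existential
  quantifier over \<open>p\<close> also covers the choice of direction.
\<close>

definition ordered_hamiltonian :: "nat \<Rightarrow> 'a pair_pre_digraph \<Rightarrow> bool" where
  "ordered_hamiltonian r G \<longleftrightarrow>
     (\<forall>vs. length vs = r \<and> distinct vs \<and> set vs \<subseteq> pverts G \<longrightarrow>
        (\<exists>p. hamiltonian_cycle G p \<and> in_cyclic_order vs (map fst p)))"

end

theory Submission
  imports Defs "HOL-Library.Multiset"
begin

text \<open>
  The graphs are the lexicographic products of an even cycle (of length \<open>m \<ge> 4\<close>) with \<open>k\<close>
  independent vertices. Vertices in the same layer are interchangeable, so it suffices to find a
  closed walk on the cycle that visits every layer exactly \<open>k\<close> times and contains the word of
  layers of the \<open>2k + 1\<close> prescribed vertices as a cyclic subword, for any word with no letter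
  occurring more than \<open>k\<close> times. By induction on \<open>k\<close>: some cyclically consecutive letters
  \<open>p x y q\<close> satisfy \<open>x \<noteq> y\<close> and deleting \<open>x y\<close> lowers the maximal multiplicity below \<open>k\<close>. In a
  walk for the shorter word, if \<open>p \<noteq> x\<close>, one inserts after \<open>p\<close> a full turn around the cycle, whose
  direction is chosen so that \<open>x\<close> precedes \<open>y\<close>; if \<open>q \<noteq> y\<close>, the same is done in reverse. If \<open>p = x\<close>
  and \<open>q = y\<close>, one chooses a perfect matching of the cycle not joining \<open>x\<close> to \<open>y\<close> and inserts one
  back-and-forth step along each matching edge, those at \<open>x\<close> and \<open>y\<close> directly after \<open>p\<close> and \<open>q\<close>.
\<close>

section \<open>Subsequences and reversal\<close>

lemma subseq_rev:
  assumes "subseq xs ys"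
  shows "subseq (rev xs) (rev ys)"
  using assms
proof induction
  case (list_emb_Cons xs ys y)
  then show ?case by (simp add: subseq_rev_drop_many)
next
  case (list_emb_Cons2 x y xs ys)
  then show ?case by (simp add: list_emb_append_mono)
qed simp

lemma subseq_imp_mset_subseteq:
  assumes "subseq xs ys"
  shows "mset xs \<subseteq># mset ys"
  using assms
proof induction
  case (list_emb_Cons xs ys y)
  then show ?case by (auto simp: subseteq_mset_def le_SucI)
qed auto

text \<open>This is the choice of direction: of the two ways to run through a list, one meets
  \<open>a\<close> before \<open>b\<close>.\<close>

lemma subseq_pair_or_rev:
  assumes "a \<in> set xs" "b \<in> set xs" "a \<noteq> b"
  shows "subseq [a, b] xs \<or> subseq [a, b] (rev xs)"
proof -
  obtain us vs where xs: "xs = us @ a # vs"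
    using assms(1) by (meson split_list)
  from assms xs consider "b \<in> set us" | "b \<in> set vs" by auto
  then show ?thesis
  proof cases
    case 1
    then have "subseq [b] us" by (simp add: subseq_singleton_left)
    then have "subseq ([b] @ [a]) (us @ [a])" by (intro list_emb_append_mono) auto
    then have "subseq [b, a] xs"
      using subseq_rev_drop_many[of "[b, a]" "us @ [a]" vs] xs by simp
    then show ?thesis using subseq_rev by fastforce
  next
    case 2
    then have "subseq [b] vs" by (simp add: subseq_singleton_left)
    then show ?thesis unfolding xs by (intro disjI1 subseq_drop_many) simp
  qed
qed

section \<open>Closed walks, and lifting a list along a map\<close>

definition closed_walk :: "('a \<Rightarrow> 'a \<Rightarrow> bool) \<Rightarrow> 'a list \<Rightarrow> bool" where
  "closed_walk E c \<longleftrightarrow> c \<noteq> [] \<and> successively E c \<and> E (last c) (hd c)"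

lemma closed_walk_swap:
  "closed_walk E (xs @ ys) \<longleftrightarrow> closed_walk E (ys @ xs)"
  by (cases "xs = []"; cases "ys = []") (auto simp: closed_walk_def successively_append_iff)

text \<open>The list \<open>ts\<close> is a detour that leaves \<open>p\<close> and returns to it.
  Rotating \<open>p\<close> to the front makes the wrap-around edge harmless.\<close>

lemma closed_walk_insert:
  assumes "closed_walk E (us @ p # vs)" "successively E (p # ts)" "ts \<noteq> []" "last ts = p"
  shows "closed_walk E (us @ p # ts @ vs)"
proof -
  have "closed_walk E (p # vs @ us)"
    using assms(1) closed_walk_swap[of E us "p # vs"] by simp
  then have "closed_walk E (p # ts @ vs @ us)"
    using assms(2-4)
    by (auto simp: closed_walk_def successively_append_iff successively_Cons split: if_splits)
  then show ?thesis
    using closed_walk_swap[of E us "p # ts @ vs"] by simp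
qed

text \<open>Vertices with the same value under \<open>f\<close> are interchangeable, so the entries
  of \<open>c\<close> can be replaced greedily by vertices, from left to right, as long as the
  prescribed ones still find their places.\<close>

lemma lift_enumeration:
  assumes "finite V" "mset c = image_mset f (mset_set V)"
    and "distinct vs" "set vs \<subseteq> V" "subseq (map f vs) c"
  shows "\<exists>C. map f C = c \<and> distinct C \<and> set C = V \<and> subseq vs C"
  using assms
proof (induction c arbitrary: V vs)
  case Nil
  then show ?case by (auto simp: mset_set_empty_iff)
next
  case (Cons x c)
  have step: ?case
    if v: "v \<in> V" "f v = x" and ws: "distinct ws" "set ws \<subseteq> V - {v}" "subseq (map f ws) c"
      and lift: "\<And>C. subseq ws C \<Longrightarrow> subseq vs (v # C)" for v ws
  proof -
    have "mset_set V = add_mset v (mset_set (V - {v}))"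
      using v Cons.prems(1) by (simp add: mset_set.remove)
    then have "mset c = image_mset f (mset_set (V - {v}))"
      using Cons.prems(2) v by simp
    then obtain C where "map f C = c" "distinct C" "set C = V - {v}" "subseq ws C"
      using Cons.IH[of "V - {v}" ws] Cons.prems(1) ws by auto
    then show ?thesis
      using v lift by (intro exI[of _ "v # C"]) auto
  qed
  \<comment> \<open>If the prescribed word still fits into the tail, the head receives a spare
    vertex outside \<open>vs\<close>. Otherwise every embedding uses the head for the first entry of
    \<open>vs\<close>, so it receives that vertex.\<close>
  show ?case
  proof (cases "subseq (map f vs) c")
    case True
    have "mset_set V = mset vs + mset_set (V - set vs)"
      using Cons.prems by (metis Diff_partition finite_Diff finite_set mset_set_Union
          mset_set_set Diff_disjoint)
    then have eq: "add_mset x (mset c) = mset (map f vs) + image_mset f (mset_set (V - set vs))"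
      using Cons.prems(2) by simp
    obtain N where "mset c = mset (map f vs) + N"
      using True subseq_imp_mset_subseteq by (metis subset_mset.le_iff_add)
    \<comment> \<open>The tail alone already covers the values of \<open>vs\<close>, so
      \<open>x\<close> is surplus and must be the value of some vertex outside
      \<open>vs\<close>.\<close>
    with eq have "x \<in># image_mset f (mset_set (V - set vs))"
      by (metis add_left_imp_eq union_mset_add_mset_right union_single_eq_member)
    then obtain v where "v \<in> V - set vs" "f v = x"
      using Cons.prems(1) by auto
    then show ?thesis
      using step[of v vs] Cons.prems True by auto
  next
    case False
    then obtain v ws where "vs = v # ws" "f v = x" "subseq (map f ws) c"
      using Cons.prems(5) by (cases vs) (auto split: if_splits)
    then show ?thesis
      using step[of v ws] Cons.prems by auto
  qed
qed

section \<open>Closed walks on an even cycle\<close>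

locale even_cycle =
  fixes E :: "'a \<Rightarrow> 'a \<Rightarrow> bool" and z :: "'a list"
  assumes E_sym: "E x y \<Longrightarrow> E y x"
    and closed_z: "closed_walk E z"
    and even_z: "even (length z)"
    and length_z: "4 \<le> length z"
begin

text \<open>This is the trace that an ordered Hamiltonian cycle leaves on the layers. Containment of
  \<open>ls\<close> is linear here; \<open>threads_swap\<close> and \<open>threads_rev\<close> turn
  it into a property of cyclic words up to reversal.\<close>

definition threads :: "nat \<Rightarrow> 'a list \<Rightarrow> bool" where
  "threads k ls \<longleftrightarrow>
     (\<exists>c. closed_walk E c \<and> mset c = repeat_mset k (mset z) \<and> subseq ls c)"

lemma closed_walk_rev: "closed_walk E c \<Longrightarrow> closed_walk E (rev c)"
  by (auto simp: closed_walk_def hd_rev last_rev intro: E_sym successively_mono)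

lemma threads_rev: "threads k ls \<Longrightarrow> threads k (rev ls)"
  unfolding threads_def by (metis closed_walk_rev mset_rev subseq_rev)

text \<open>Cutting the walk between the places used by \<open>xs\<close> and by \<open>ys\<close>
  and exchanging the two pieces gives a closed walk again.\<close>

lemma threads_swap:
  assumes "threads k (xs @ ys)"
  shows "threads k (ys @ xs)"
proof -
  obtain c where c: "closed_walk E c" "mset c = repeat_mset k (mset z)" "subseq (xs @ ys) c"
    using assms unfolding threads_def by blast
  obtain us vs where "c = us @ vs" "subseq xs us" "subseq ys vs"
    using list_emb_appendD[OF c(3)] by blast
  then show ?thesis
    using c closed_walk_swap[of E us vs] unfolding threads_def
    by (intro exI[of _ "vs @ us"]) (auto simp: union_commute intro: list_emb_append_mono)
qed

lemma cycle_from: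
  assumes "p \<in> set z"
  obtains R where "closed_walk E (p # R)" "mset (p # R) = mset z"
proof -
  obtain us vs where "z = us @ p # vs"
    using assms by (meson split_list)
  then show ?thesis
    using that[of "vs @ us"] closed_z closed_walk_swap[of E us "p # vs"] by simp
qed

text \<open>The turn starts after \<open>p\<close> and ends with \<open>p\<close>. As
  \<open>a\<close> differs from \<open>p\<close>, it is met before this final return, which settles
  \<open>b = p\<close>; for any other \<open>b\<close> one of the two directions meets
  \<open>a\<close> first.\<close>

lemma turn_through:
  assumes "p \<in> set z" "a \<in> set z" "b \<in> set z" "p \<noteq> a" "a \<noteq> b"
  obtains T where "successively E (p # T)" "T \<noteq> []" "last T = p" "mset T = mset z"
    "subseq [a, b] T"
proof -
  obtain R where R: "closed_walk E (p # R)" "mset (p # R) = mset z"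
    using assms(1) by (rule cycle_from)
  have aR: "a \<in> set R"
    using R(2) assms(2,4) by (metis set_ConsD set_mset_mset)
  have bR: "b \<in> set R" if "b \<noteq> p"
    using R(2) assms(3) that by (metis set_ConsD set_mset_mset)
  have "R \<noteq> []" using aR by auto
  then have walk: "successively E (p # R @ [p])"
    using R(1) by (auto simp: closed_walk_def successively_append_iff successively_Cons)
  then have "successively E (rev (p # R @ [p]))"
    unfolding successively_rev by (rule successively_mono) (auto intro: E_sym)
  then have walk': "successively E (p # rev R @ [p])" by simp
  have "subseq [a, b] (R @ [p]) \<or> subseq [a, b] (rev R @ [p])"
  proof (cases "b = p")
    case True
    have "subseq ([a] @ [p]) (R @ [p])"
      using aR by (intro list_emb_append_mono) (auto simp: subseq_singleton_left)
    then show ?thesis using True by simp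
  next
    case False
    then show ?thesis
      using subseq_pair_or_rev[OF aR bR] assms(5) subseq_rev_drop_many by blast
  qed
  then show ?thesis
    using that[of "R @ [p]"] that[of "rev R @ [p]"] walk walk' R(2) by auto
qed

lemma threads_turn:
  assumes "threads k (p # rest)" "p \<in> set z" "a \<in> set z" "b \<in> set z" "p \<noteq> a" "a \<noteq> b"
  shows "threads (Suc k) (p # a # b # rest)"
proof -
  obtain c where c: "closed_walk E c" "mset c = repeat_mset k (mset z)" "subseq (p # rest) c"
    using assms(1) unfolding threads_def by blast
  obtain us vs where split: "c = us @ p # vs" "subseq rest vs"
    using list_emb_ConsD[OF c(3)] by blast
  obtain T where T: "successively E (p # T)" "T \<noteq> []" "last T = p" "mset T = mset z"
    "subseq [a, b] T"
    using assms(2-) by (rule turn_through)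
  have "closed_walk E (us @ p # T @ vs)"
    using c(1) T split by (intro closed_walk_insert) auto
  moreover have "mset (us @ p # T @ vs) = repeat_mset (Suc k) (mset z)"
    using c(2) T(4) split by simp
  moreover have "subseq (p # [a, b] @ rest) (us @ p # T @ vs)"
    using T(5) split(2) by (intro subseq_drop_many subseq_Cons2 list_emb_append_mono)
  ultimately show ?thesis unfolding threads_def by auto
qed

text \<open>The endpoints of the edges \<open>ps\<close>, with multiplicity, are what zigzags along
  these edges add to a walk. A perfect matching adds \<open>mset z\<close>, just like a full
  turn.\<close>

definition pair_mset :: "('a \<times> 'a) list \<Rightarrow> 'a multiset" where
  "pair_mset ps = mset (map fst ps) + mset (map snd ps)"

text \<open>Replacing one visit \<open>x\<close> by \<open>x y x\<close> adds one visit to each end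
  of the edge. Earlier visits survive, so the starting points of the remaining edges stay on the
  walk.\<close>

lemma closed_walk_zigzags:
  assumes "\<forall>(x, y) \<in> set ps. E x y" "fst ` set ps \<subseteq> set c" "closed_walk E c"
  shows "\<exists>c'. closed_walk E c' \<and> mset c' = mset c + pair_mset ps \<and> subseq c c'"
  using assms
proof (induction ps arbitrary: c)
  case (Cons xy ps)
  obtain x y where xy: "xy = (x, y)" by force
  obtain us vs where c: "c = us @ x # vs"
    using Cons.prems(2) xy by (auto dest: split_list)
  let ?d = "us @ x # [y, x] @ vs"
  have "closed_walk E ?d"
    using Cons.prems c xy by (intro closed_walk_insert) (auto intro: E_sym)
  moreover have "fst ` set ps \<subseteq> set ?d" using Cons.prems(2) c by auto
  ultimately obtain c' where "closed_walk E c'" "mset c' = mset ?d + pair_mset ps" "subseq ?d c'"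
    using Cons.IH[of ?d] Cons.prems(1) by auto
  moreover have "subseq c ?d"
    unfolding c by (intro list_emb_append_mono subseq_Cons2 subseq_drop_many) auto
  ultimately show ?case
    using subseq_order.trans by (intro exI[of _ c']) (auto simp: c xy pair_mset_def)
qed (auto simp: pair_mset_def)

text \<open>Every second edge of the walk is taken, beginning with the first.\<close>

lemma even_walk_pairs:
  assumes "successively E xs" "even (length xs)"
  shows "\<exists>ps. (\<forall>(x, y) \<in> set ps. E x y) \<and> mset xs = pair_mset ps"
  using assms
proof (induction xs rule: induct_list012)
  case 1
  then show ?case by (auto simp: pair_mset_def)
next
  case (3 x y xs)
  then obtain ps where "\<forall>(x, y) \<in> set ps. E x y" "mset xs = pair_mset ps"
    by (auto simp: successively_Cons)
  then show ?case
    using "3.prems"(1) by (intro exI[of _ "(x, y) # ps"]) (auto simp: pair_mset_def)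
qed auto

text \<open>Of the two perfect matchings contained in an even cycle, at least one does not join \<open>a\<close>
  to \<open>b\<close>.\<close>

lemma matching_separating:
  assumes "a \<in> set z" "b \<in> set z" "a \<noteq> b"
  obtains a' b' ps where "E a a'" "E b b'" "\<forall>(x, y) \<in> set ps. E x y"
    "mset z = {#a, a', b, b'#} + pair_mset ps"
proof -
  obtain R where R: "closed_walk E (a # R)" "mset (a # R) = mset z"
    using assms(1) by (rule cycle_from)
  have len: "length R = length z - 1"
    using R(2) by (metis diff_Suc_1 length_Cons size_mset)
  have oddR: "odd (length R)" "3 \<le> length R"
    using len even_z length_z by auto
  have bR: "b \<in> set R"
    using R(2) assms(2,3) by (metis set_ConsD set_mset_mset)
  have "\<exists>a' xs. E a a' \<and> successively E xs \<and> even (length xs) \<and> b \<in> set xs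
      \<and> mset R = mset (a' # xs)"
  \<comment> \<open>The vertex \<open>a\<close> is matched with its neighbour at one end of
    \<open>R\<close>: the last entry if \<open>b\<close> is the first one, and the first entry
    otherwise. Either way \<open>b\<close> remains in the even walk \<open>xs\<close> and finds its
    partner there.\<close>
  proof (cases "b = hd R")
    case True
    obtain a' xs where R': "rev R = a' # xs" using oddR by (cases "rev R") auto
    have R'': "R = rev xs @ [a']" using R' by (metis rev_rev_ident rev.simps(2))
    have "xs \<noteq> []" using R'' oddR by auto
    have "E a' a"
      using R(1) R'' by (auto simp: closed_walk_def)
    moreover have "successively E (rev xs)"
      using R(1) R'' by (auto simp: closed_walk_def successively_append_iff successively_Cons)
    then have "successively E xs"
      unfolding successively_rev by (rule successively_mono) (auto intro: E_sym)
    moreover have "even (length xs)" using oddR(1) R'' by simp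
    moreover have "b \<in> set xs"
      using True R'' \<open>xs \<noteq> []\<close> by (simp add: hd_rev)
    ultimately show ?thesis
      using R'' by (intro exI[of _ a'] exI[of _ xs]) (auto intro: E_sym)
  next
    case False
    obtain a' xs where "R = a' # xs" using oddR by (cases R) auto
    then show ?thesis
      using R(1) oddR bR False
      by (intro exI[of _ a'] exI[of _ xs]) (auto simp: closed_walk_def successively_Cons)
  qed
  then obtain a' xs where xs: "E a a'" "successively E xs" "even (length xs)" "b \<in> set xs"
    "mset R = mset (a' # xs)" by blast
  obtain ps where ps: "\<forall>(x, y) \<in> set ps. E x y" "mset xs = pair_mset ps"
    using even_walk_pairs xs by blast
  have "b \<in># pair_mset ps" using xs(4) ps(2) by (metis set_mset_mset)
  then obtain x y where xy: "(x, y) \<in> set ps" "b = x \<or> b = y"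
    by (auto simp: pair_mset_def)
  then obtain us vs where split: "ps = us @ (x, y) # vs" by (meson split_list)
  have total: "mset z = {#a, a', x, y#} + pair_mset (us @ vs)"
    using xs(5) ps(2) split by (auto simp: pair_mset_def R(2)[symmetric])
  have ex: "E x y" "\<forall>(x, y) \<in> set (us @ vs). E x y" using ps split by auto
  from xy(2) show ?thesis
  proof
    assume "b = x"
    then show ?thesis using that[of a' y "us @ vs"] xs(1) ex total by simp
  next
    assume "b = y"
    then show ?thesis
      using that[of a' x "us @ vs"] xs(1) ex total E_sym by (simp add: add_mset_commute)
  qed
qed

text \<open>The zigzags at \<open>a\<close> and \<open>b\<close> are placed directly after the
  visits that carry these letters, which doubles each letter in place. They must run along two
  different edges: a single zigzag between \<open>a\<close> and \<open>b\<close> could not do this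
  at both places.\<close>

lemma threads_zigzag:
  assumes "threads k (a # b # rest)" "a \<in> set z" "b \<in> set z" "a \<noteq> b" "0 < k"
  shows "threads (Suc k) (a # a # b # b # rest)"
proof -
  obtain c where c: "closed_walk E c" "mset c = repeat_mset k (mset z)" "subseq (a # b # rest) c"
    using assms(1) unfolding threads_def by blast
  obtain us vs where c1: "c = us @ a # vs" "subseq (b # rest) vs"
    using list_emb_ConsD[OF c(3)] by blast
  obtain vs' ws where c2: "vs = vs' @ b # ws" "subseq rest ws"
    using list_emb_ConsD[OF c1(2)] by blast
  obtain a' b' ps where m: "E a a'" "E b b'" "\<forall>(x, y) \<in> set ps. E x y"
    "mset z = {#a, a', b, b'#} + pair_mset ps"
    using assms(2-4) by (rule matching_separating)
  let ?d = "us @ a # [a', a] @ vs' @ b # [b', b] @ ws"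
  have "closed_walk E (us @ a # [a', a] @ vs)"
    using c(1) c1(1) m(1) by (intro closed_walk_insert) (auto intro: E_sym)
  then have "closed_walk E ((us @ a # [a', a] @ vs') @ b # ws)"
    by (simp add: c2(1))
  then have "closed_walk E ((us @ a # [a', a] @ vs') @ b # [b', b] @ ws)"
    using m(2) by (intro closed_walk_insert) (auto intro: E_sym)
  then have closed_d: "closed_walk E ?d" by simp
  \<comment> \<open>As \<open>k\<close> is positive, the walk already visits every vertex, so each
    remaining matching edge has a place where its zigzag can be inserted.\<close>
  obtain j where "k = Suc j" using assms(5) by (cases k) auto
  then have "mset c = mset z + repeat_mset j (mset z)" using c(2) by simp
  then have "set z \<subseteq> set c" by (metis Un_upper1 set_mset_mset set_mset_union)
  moreover have "fst ` set ps \<subseteq> set_mset (mset z)"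
    unfolding m(4) by (auto simp: pair_mset_def)
  ultimately have "fst ` set ps \<subseteq> set ?d"
    using c1 c2 by auto
  then obtain c' where c': "closed_walk E c'" "mset c' = mset ?d + pair_mset ps" "subseq ?d c'"
    using closed_walk_zigzags m(3) closed_d by blast
  have "mset c' = mset c + mset z"
    using c'(2) c1 c2 m(4) by simp
  moreover have "subseq (a # [a] @ b # [b] @ rest) ?d"
    using c2(2)
    by (intro subseq_drop_many subseq_Cons2 list_emb_append_mono) (auto intro: subseq_drop_many)
  ultimately show ?thesis
    unfolding threads_def using c c' subseq_order.trans by (intro exI[of _ c']) auto
qed

lemma threads_step:
  assumes "threads k (p # q # rest)" "set [p, x, y, q] \<subseteq> set z" "x \<noteq> y" "0 < k"
  shows "threads (Suc k) (p # x # y # q # rest)"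
proof -
  consider "p \<noteq> x" | "q \<noteq> y" | "p = x" "q = y" by blast
  then show ?thesis
  proof cases
    case 1
    then show ?thesis using assms by (intro threads_turn) auto
  next
    case 2
    have "threads k (rev (q # rest @ [p]))"
      using threads_rev[OF threads_swap[of k "[p]" "q # rest"]] assms(1) by simp
    then have "threads k (q # p # rev rest)"
      using threads_swap[of k "p # rev rest" "[q]"] by simp
    then have "threads (Suc k) (q # y # x # p # rev rest)"
      using assms 2 by (intro threads_turn) auto
    then have "threads (Suc k) (rest @ [p, x, y, q])"
      using threads_rev by fastforce
    then show ?thesis using threads_swap[of "Suc k" rest "[p, x, y, q]"] by simp
  next
    case 3
    then show ?thesis using assms threads_zigzag[of k x y rest] by auto
  qed
qed

end

section \<open>Letter multiplicities in cyclic words\<close>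

lemma first_change:
  assumes "set (a # xs) \<noteq> {a}"
  obtains us y vs where "a # xs = us @ a # y # vs" "y \<noteq> a"
proof -
  have "\<exists>us y vs. a # xs = us @ a # y # vs \<and> y \<noteq> a"
    using assms
  proof (induction xs)
    case (Cons b xs)
    show ?case
    proof (cases "b = a")
      case True
      then obtain us y vs where "a # xs = us @ a # y # vs" "y \<noteq> a"
        using Cons by auto
      then show ?thesis
        using True by (intro exI[of _ "a # us"] exI[of _ y] exI[of _ vs]) auto
    next
      case False
      then show ?thesis by (intro exI[of _ "[]"]) auto
    qed
  qed auto
  then show ?thesis using that by blast
qed

text \<open>At most two letters can have the maximal multiplicity \<open>k\<close>, and if there are two, then only
  one further position remains, which cannot separate them on both sides of the cyclic word.\<close>

lemma ex_reducing_change: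
  assumes "length ls = 2 * k + 1" "2 \<le> k" "\<And>x. count_list ls x \<le> k"
  obtains n x y ws where "rotate n ls = x # y # ws" "x \<noteq> y"
    "\<And>w. w \<noteq> x \<Longrightarrow> w \<noteq> y \<Longrightarrow> count_list ls w < k"
proof (cases "\<exists>a b. a \<noteq> b \<and> count_list ls a = k \<and> count_list ls b = k")
  case True
  then obtain a b where ab: "a \<noteq> b" "count_list ls a = k" "count_list ls b = k" by blast
  let ?P = "\<lambda>w. w \<noteq> a \<and> w \<noteq> b"
  have "length xs = count_list xs a + count_list xs b + length (filter ?P xs)" for xs
    using ab(1) by (induction xs) auto
  then have one: "length (filter ?P ls) = 1"
    using assms(1) ab by (metis add_left_imp_eq mult_2)
  then obtain c where "filter ?P ls = [c]"
    by (metis One_nat_def length_0_conv length_Suc_conv)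
  then obtain us vs where ls: "ls = us @ c # vs" and c: "c \<noteq> a" "c \<noteq> b"
    and rest: "\<forall>w \<in> set (vs @ us). w = a \<or> w = b"
    by (auto simp: filter_eq_Cons_iff filter_empty_conv eq_commute[of "[]" "filter _ _"])
  have mem: "a \<in> set (vs @ us)" "b \<in> set (vs @ us)"
  proof -
    have "count_list (vs @ us) a = k" "count_list (vs @ us) b = k"
      using ab c unfolding ls by auto
    then show "a \<in> set (vs @ us)" "b \<in> set (vs @ us)"
      using assms(2) count_notin[of _ "vs @ us"] by fastforce+
  qed
  \<comment> \<open>The cyclic word is cut at its only foreign letter \<open>c\<close>. What remains
    is a linear word in \<open>a\<close> and \<open>b\<close> containing both, so its first change
    is an adjacent pair of these two letters.\<close>
  obtain h t where ht: "vs @ us = h # t" using mem by (cases "vs @ us") auto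
  have "set (h # t) \<noteq> {h}" using mem ab(1) unfolding ht by auto
  then obtain us' y vs' where sp: "h # t = us' @ h # y # vs'" "y \<noteq> h"
    by (rule first_change)
  have "rotate (length us) ls = (c # us') @ (h # y # vs')"
    using ls ht sp rotate_append[of us "c # vs"] by simp
  then have "rotate (length (c # us')) (rotate (length us) ls) = (h # y # vs') @ (c # us')"
    by (simp only: rotate_append)
  moreover have "{h, y} = {a, b}"
    using rest sp ht by auto
  \<comment> \<open>A third letter occurs at most once, which is below \<open>k\<close> because
    \<open>2 \<le> k\<close>.\<close>
  moreover have "count_list ls w < k" if "w \<noteq> a" "w \<noteq> b" for w
  proof -
    have "count_list xs w \<le> length (filter ?P xs)" for xs
      using that by (induction xs) auto
    from this[of ls] show ?thesis using one assms(2) by linarith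
  qed
  ultimately show ?thesis
    using that[of "length (c # us') + length us" h y "vs' @ c # us'"] sp(2)
    by (auto simp: rotate_rotate doubleton_eq_iff)
next
  case False
  \<comment> \<open>The letter \<open>a\<close> is the one of multiplicity \<open>k\<close> if there
    is one, and any letter of the word otherwise. Then every change that involves \<open>a\<close>
    is good enough.\<close>
  then obtain a where a: "a \<in> set ls" "\<And>w. w \<noteq> a \<Longrightarrow> count_list ls w < k"
  proof (cases "\<exists>a. count_list ls a = k")
    case True
    then obtain a where "count_list ls a = k" by blast
    then show ?thesis
      using that[of a] False assms(2,3) count_notin[of a ls]
      by (metis le_neq_implies_less not_numeral_le_zero)
  next
    case none: False
    have "hd ls \<in> set ls" using assms(1) by (intro hd_in_set) auto
    moreover have "count_list ls w < k" for w
      using none assms(3)[of w] by (simp add: le_less)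
    ultimately show ?thesis using that by blast
  qed
  then obtain us vs where ls: "ls = us @ a # vs" by (meson split_list)
  have "set (a # vs @ us) \<noteq> {a}"
  proof
    assume "set (a # vs @ us) = {a}"
    then have "\<forall>w \<in> set ls. w = a" using ls by auto
    then have "count_list ls a = length ls" by (induction ls) auto
    then show False using assms(1) assms(3)[of a] by simp
  qed
  then obtain us' y vs' where sp: "a # vs @ us = us' @ a # y # vs'" "y \<noteq> a"
    by (rule first_change)
  have "rotate (length us) ls = us' @ a # y # vs'"
    using ls sp(1) rotate_append[of us "a # vs"] by simp
  then have "rotate (length us') (rotate (length us) ls) = (a # y # vs') @ us'"
    by (simp only: rotate_append)
  then show ?thesis
    using that[of "length us' + length us" a y "vs' @ us'"] sp(2) a(2) by (auto simp: rotate_rotate)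
qed

section \<open>Induction on the multiplicity\<close>

context even_cycle
begin

lemma threads_rotateD:
  assumes "threads k (rotate n ls)"
  shows "threads k ls"
proof -
  let ?n = "n mod length ls"
  have "threads k (take ?n ls @ drop ?n ls)"
    using assms threads_swap[of k "drop ?n ls" "take ?n ls"] by (simp add: rotate_drop_take)
  then show ?thesis by simp
qed

text \<open>Three distinct vertices have only two cyclic orders, and the two directions around the
  cycle realize both.\<close>

lemma threads_one:
  assumes "distinct [p, a, b]" "set [p, a, b] \<subseteq> set z"
  shows "threads 1 [p, a, b]"
proof -
  obtain R where R: "closed_walk E (p # R)" "mset (p # R) = mset z"
    using assms(2) cycle_from[of p] by auto
  have "closed_walk E (rev R @ [p])"
    using closed_walk_rev[OF R(1)] by simp
  then have R': "closed_walk E (p # rev R)"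
    using closed_walk_swap[of E "rev R" "[p]"] by simp
  have "set (p # R) = set z" using R(2) by (metis set_mset_mset)
  then have "a \<in> set R" "b \<in> set R" using assms by auto
  then have "subseq [a, b] R \<or> subseq [a, b] (rev R)"
    using assms(1) by (intro subseq_pair_or_rev) auto
  then show ?thesis
    unfolding threads_def using R R' by (auto intro: exI[of _ "p # R"] exI[of _ "p # rev R"])
qed

theorem threads_odd:
  assumes "1 \<le> k" "length ls = 2 * k + 1" "set ls \<subseteq> set z" "\<And>x. count_list ls x \<le> k"
  shows "threads k ls"
  using assms
proof (induction k arbitrary: ls rule: nat_induct_at_least)
  case base
  then obtain p a b where ls: "ls = [p, a, b]"
    by (auto simp: numeral_eq_Suc length_Suc_conv)
  have "distinct [p, a, b]"
    using base(3)[of p] base(3)[of a] unfolding ls by (auto split: if_splits)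
  then show ?case using base(2) threads_one unfolding ls by auto
next
  case (Suc k)
  obtain n x y ws where rot: "rotate n ls = x # y # ws" "x \<noteq> y"
    and less: "\<And>w. w \<noteq> x \<Longrightarrow> w \<noteq> y \<Longrightarrow> count_list ls w < Suc k"
    using ex_reducing_change[OF Suc.prems(1) _ Suc.prems(3)] Suc.hyps
    by (metis Suc_1 Suc_le_mono)
  have "length (x # y # ws) = 2 * k + 3"
    using Suc.prems(1) by (simp flip: rot(1))
  \<comment> \<open>The word has length at least five, so the neighbours \<open>p\<close> and
    \<open>q\<close> of the deleted pair occupy different positions.\<close>
  then have "2 \<le> length ws" using Suc.hyps by simp
  then obtain q ws0 where "ws = q # ws0" "ws0 \<noteq> []"
    by (cases ws) (auto simp: Suc_le_length_iff)
  then obtain ws' p where ws: "ws = q # ws' @ [p]" by (metis rev_exhaust)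
  have mset: "mset ls = mset (p # x # y # q # ws')"
  proof -
    have "mset ls = mset (rotate n ls)"
      by (metis append_take_drop_id mset_append rotate_drop_take union_commute)
    then show ?thesis unfolding rot(1) ws by simp
  qed
  have "set ls = set (p # x # y # q # ws')" using mset by (metis set_mset_mset)
  then have sub: "set (p # x # y # q # ws') \<subseteq> set z" using Suc.prems(2) by simp
  have count: "count_list ls w = count_list (p # x # y # q # ws') w" for w
    using mset by (metis count_mset)
  have "threads k (p # q # ws')"
  proof (rule Suc.IH)
    show "length (p # q # ws') = 2 * k + 1"
      using \<open>length (x # y # ws) = 2 * k + 3\<close> ws by simp
    show "set (p # q # ws') \<subseteq> set z" using sub by auto
    show "count_list (p # q # ws') w \<le> k" for w
      using Suc.prems(3)[of w] less[of w] count[of w] rot(2) by (auto split: if_splits)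
  qed
  then have "threads (Suc k) (p # x # y # q # ws')"
    using sub rot(2) Suc.hyps by (intro threads_step) auto
  then have "threads (Suc k) (rotate n ls)"
    using threads_swap[of "Suc k" "[p]" "x # y # q # ws'"] rot(1) ws by simp
  then show ?case by (rule threads_rotateD)
qed

end

section \<open>The blown-up even cycles\<close>

definition ring_adj :: "nat \<Rightarrow> nat \<Rightarrow> nat \<Rightarrow> bool" where
  "ring_adj m x y \<longleftrightarrow> y = Suc x mod m \<or> x = Suc y mod m"

lemma ring_adj_iff:
  assumes "x < m" "y < m"
  shows "ring_adj m x y \<longleftrightarrow>
    y = (if Suc x = m then 0 else Suc x) \<or> y = (if x = 0 then m - 1 else x - 1)"
proof -
  have "Suc x mod m = (if Suc x = m then 0 else Suc x)"
    "Suc y mod m = (if Suc y = m then 0 else Suc y)"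
    using assms by auto
  then show ?thesis using assms by (auto simp: ring_adj_def)
qed

lemma even_cycle_ring:
  assumes "even m" "4 \<le> m"
  shows "even_cycle (ring_adj m) [0..<m]"
proof
  have "successively (ring_adj m) [0..<n]" if "n \<le> m" for n
    using that
    by (induction n) (auto simp: successively_append_iff ring_adj_def last_conv_nth)
  then show "closed_walk (ring_adj m) [0..<m]"
    using assms by (auto simp: closed_walk_def ring_adj_def)
qed (use assms in \<open>auto simp: ring_adj_def\<close>)

text \<open>The vertex \<open>v\<close> is the copy number \<open>v div m\<close> of the vertex \<open>v mod m\<close> of the cycle.\<close>

definition blowup :: "nat \<Rightarrow> nat \<Rightarrow> nat pair_pre_digraph" where
  "blowup m k = \<lparr>pverts = {..<m * k},
     parcs = {(u, v). u < m * k \<and> v < m * k \<and> ring_adj m (u mod m) (v mod m)}\<rparr>"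

lemma card_layer:
  fixes m k x :: nat
  assumes "x < m"
  shows "card {w. w < m * k \<and> w mod m = x} = k"
proof -
  have "{w. w < m * k \<and> w mod m = x} = (\<lambda>j. x + m * j) ` {..<k}"
  proof safe
    fix w assume w: "w < m * k" "x = w mod m"
    then have "w div m < k" by (simp add: less_mult_imp_div_less mult.commute)
    then show "w \<in> (\<lambda>j. w mod m + m * j) ` {..<k}"
      by (intro image_eqI[of _ _ "w div m"]) auto
  next
    fix j assume "j < k"
    then have "m * (j + 1) \<le> m * k" by (intro mult_le_mono2) simp
    then show "x + m * j < m * k" using assms by simp
  qed (use assms in auto)
  moreover have "inj_on (\<lambda>j. x + m * j) {..<k}"
    using assms by (auto intro: inj_onI)
  ultimately show ?thesis by (simp add: card_image)
qed

text \<open>This identifies the visit count demanded by \<open>threads\<close> with the one that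
  \<open>lift_enumeration\<close> expects of an enumeration of all vertices.\<close>

lemma image_mset_layers:
  assumes "0 < m"
  shows "image_mset (\<lambda>v. v mod m) (mset_set {..<m * k}) = repeat_mset k (mset [0..<m])"
proof (rule multiset_eqI)
  fix x
  have "count (image_mset (\<lambda>v. v mod m) (mset_set {..<m * k})) x
      = card {w. w < m * k \<and> w mod m = x}"
    by (simp add: count_image_mset_eq_card_vimage)
  also have "\<dots> = (if x < m then k else 0)"
    using card_layer[of x m k] assms by auto
  finally show "count (image_mset (\<lambda>v. v mod m) (mset_set {..<m * k})) x
      = count (repeat_mset k (mset [0..<m])) x"
    by (simp add: count_mset_set')
qed

lemma pair_graph_blowup:
  assumes "4 \<le> m"
  shows "pair_graph (blowup m k)"
proof
  have "finite ({..<m * k} \<times> {..<m * k})" by simp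
  then show "finite (parcs (blowup m k))"
    by (rule rev_finite_subset) (auto simp: blowup_def)
  show "symmetric (with_proj (blowup m k))"
    by (auto simp: symmetric_def sym_def blowup_def ring_adj_def)
  fix e assume "e \<in> parcs (blowup m k)"
  then have "ring_adj m (fst e mod m) (snd e mod m)" by (auto simp: blowup_def)
  then show "fst e \<noteq> snd e"
    using assms ring_adj_iff[of "fst e mod m" m "fst e mod m"] by (force split: if_splits)
qed (auto simp: blowup_def)

lemma regular_blowup:
  assumes "4 \<le> m"
  shows "regular_graph (2 * k) (blowup m k)"
  unfolding regular_graph_def
proof
  fix v assume "v \<in> pverts (blowup m k)"
  then have v: "v < m * k" by (simp add: blowup_def)
  let ?L = "\<lambda>x. {w. w < m * k \<and> w mod m = x}"
  define x where "x = v mod m"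
  define s where "s = (if Suc x = m then 0 else Suc x)"
  define p where "p = (if x = 0 then m - 1 else x - 1)"
  have x: "x < m" using assms by (simp add: x_def)
  \<comment> \<open>The two neighbouring layers \<open>s\<close> and \<open>p\<close> are different
    since \<open>4 \<le> m\<close>; their sizes therefore add up.\<close>
  have sp: "s < m" "p < m" "s \<noteq> p" using x assms by (auto simp: s_def p_def)
  have "ring_adj m (v mod m) (w mod m) \<longleftrightarrow> w mod m = s \<or> w mod m = p" for w
    using ring_adj_iff[of x m "w mod m"] x assms by (simp add: x_def s_def p_def)
  then have "out_arcs (with_proj (blowup m k)) v = Pair v ` (?L s \<union> ?L p)"
    using v by (auto simp: blowup_def)
  then have "out_degree (with_proj (blowup m k)) v = card (?L s \<union> ?L p)"
    by (simp add: out_degree_def card_image inj_on_def)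
  also have "\<dots> = card (?L s) + card (?L p)"
    using sp by (intro card_Un_disjoint) auto
  also have "\<dots> = 2 * k" using sp by (simp add: card_layer)
  finally show "out_degree (with_proj (blowup m k)) v = 2 * k" .
qed

section \<open>From vertex lists to Hamiltonian cycles of arcs\<close>

lemma pcas_zip: "pcas h (zip (h # t) (t @ [w])) w"
  by (induction t arbitrary: h) auto

lemma pawalk_verts_zip: "pawalk_verts h (zip (h # t) (t @ [w])) = h # t @ [w]"
  by (induction t arbitrary: h) auto

lemma set_zip_subset_iff:
  "set (zip (h # t) (t @ [w])) \<subseteq> A \<longleftrightarrow> successively (\<lambda>x y. (x, y) \<in> A) (h # t @ [w])"
  by (induction t arbitrary: h) auto

text \<open>Zipping with \<open>rotate1 C\<close> joins each vertex to its cyclic successor, and the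
  first components give back \<open>C\<close>.\<close>

lemma hamiltonian_cycle_zip:
  assumes "closed_walk (\<lambda>x y. (x, y) \<in> parcs G) C" "distinct C" "set C = pverts G" "3 \<le> length C"
  shows "hamiltonian_cycle G (zip C (rotate1 C))"
proof -
  obtain h t where C: "C = h # t" using assms(4) by (cases C) auto
  let ?p = "zip (h # t) (t @ [h])"
  have "successively (\<lambda>x y. (x, y) \<in> parcs G) (h # t @ [h])"
    using assms(1) successively_append_iff[of _ "h # t" "[h]"] unfolding C closed_walk_def by simp
  then have "set ?p \<subseteq> parcs G" by (simp only: set_zip_subset_iff)
  moreover have "h \<in> pverts G" using assms(3) C by auto
  ultimately have "pre_digraph.awalk (with_proj G) h ?p h"
    unfolding pre_digraph.awalk_def using pcas_zip[of h t h]
    by (simp only: with_proj_simps cas_with_proj_eq)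
  \<comment> \<open>The vertices of the arc walk are \<open>h # t @ [h]\<close>; without the first
    one they form a rotation of \<open>C\<close>.\<close>
  moreover have "distinct (tl (pre_digraph.awalk_verts (with_proj G) h ?p))"
    using assms(2) C pawalk_verts_zip[of h t h] by (simp only: awalk_verts_with_proj_eq) simp
  ultimately have "pre_digraph.cycle (with_proj G) ?p"
    unfolding pre_digraph.cycle_def
    by (metis length_0_conv length_zip length_Cons length_append_singleton min.idem nat.distinct(1))
  then show ?thesis
    using assms(3,4) C by (simp add: hamiltonian_cycle_def)
qed

lemma ordered_hamiltonian_blowup:
  assumes "even m" "4 \<le> m" "1 \<le> k"
  shows "ordered_hamiltonian (2 * k + 1) (blowup m k)"
  unfolding ordered_hamiltonian_def
proof (intro allI impI)
  fix vs :: "nat list"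
  assume vs: "length vs = 2 * k + 1 \<and> distinct vs \<and> set vs \<subseteq> pverts (blowup m k)"
  let ?V = "{..<m * k}" and ?f = "\<lambda>v. v mod m"
  interpret even_cycle "ring_adj m" "[0..<m]"
    using assms by (intro even_cycle_ring)
  have sub: "set vs \<subseteq> ?V" using vs by (simp add: blowup_def)
  have "threads k (map ?f vs)"
  proof (rule threads_odd)
    fix x
    \<comment> \<open>The prescribed vertices are distinct and a layer has only \<open>k\<close>
      vertices, which bounds the multiplicity of each letter.\<close>
    have "mset vs \<subseteq># mset_set ?V"
      using vs sub by (metis finite_lessThan mset_set_set subset_imp_msubset_mset_set)
    then have "mset (map ?f vs) \<subseteq># repeat_mset k (mset [0..<m])"
      using image_mset_subseteq_mono image_mset_layers[of m k] assms
      by (metis mset_map not_numeral_le_zero neq0_conv)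
    then have "count_list (map ?f vs) x \<le> k * count (mset [0..<m]) x"
      by (metis count_mset count_repeat_mset mset_subset_eq_count)
    also have "\<dots> \<le> k" by (simp add: count_mset_set')
    finally show "count_list (map ?f vs) x \<le> k" .
  qed (use assms vs in auto)
  then obtain c where c: "closed_walk (ring_adj m) c" "mset c = repeat_mset k (mset [0..<m])"
    "subseq (map ?f vs) c"
    unfolding threads_def by blast
  have "\<exists>C. map ?f C = c \<and> distinct C \<and> set C = ?V \<and> subseq vs C"
    using c vs sub assms by (intro lift_enumeration) (auto simp: image_mset_layers)
  then obtain C where C: "map ?f C = c" "distinct C" "set C = ?V" "subseq vs C" by blast
  have "length C = m * k" using C(2,3) by (metis card_lessThan distinct_card)
  also have "4 * 1 \<le> m * k" using assms by (intro mult_le_mono)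
  finally have len: "4 \<le> length C" by simp
  \<comment> \<open>Adjacency depends only on the layers, so every lift of the closed walk
    \<open>c\<close> is a closed walk in the blow-up.\<close>
  have "closed_walk (\<lambda>x y. (x, y) \<in> parcs (blowup m k)) C"
    unfolding closed_walk_def
  proof (intro conjI)
    show "C \<noteq> []" using len by auto
    have "successively (\<lambda>x y. ring_adj m (?f x) (?f y)) C"
      using c(1) unfolding closed_walk_def C(1)[symmetric] by (simp add: successively_map)
    then show "successively (\<lambda>x y. (x, y) \<in> parcs (blowup m k)) C"
      by (rule successively_mono) (use C(3) in \<open>auto simp: blowup_def\<close>)
    have "ring_adj m (?f (last C)) (?f (hd C))"
      using c(1) \<open>C \<noteq> []\<close> unfolding closed_walk_def C(1)[symmetric] by (simp add: last_map hd_map)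
    then show "(last C, hd C) \<in> parcs (blowup m k)"
      using \<open>C \<noteq> []\<close> C(3) last_in_set[of C] hd_in_set[of C] by (auto simp: blowup_def)
  qed
  then have "hamiltonian_cycle (blowup m k) (zip C (rotate1 C))"
    using C len by (intro hamiltonian_cycle_zip) (auto simp: blowup_def)
  moreover have "in_cyclic_order vs (map fst (zip C (rotate1 C)))"
    unfolding in_cyclic_order_def using C(4) by (intro exI[of _ 0]) simp
  ultimately show "\<exists>p. hamiltonian_cycle (blowup m k) p \<and> in_cyclic_order vs (map fst p)"
    by blast
qed

section \<open>The infinite family\<close>

lemma digraph_iso_card_verts:
  assumes "digraph_iso G H"
  shows "card (verts G) = card (verts H)"
  using assms unfolding digraph_iso_def pre_digraph.digraph_isomorphism_def
  by (auto simp: card_image verts_app_iso)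

theorem theorem2p2:
  fixes k :: nat
  assumes "k \<ge> 1"
  shows "\<exists>\<F> :: nat pair_pre_digraph set.
           infinite \<F> \<and>
           pairwise (\<lambda>G H. \<not> digraph_iso (with_proj G) (with_proj H)) \<F> \<and>
           (\<forall>G \<in> \<F>. pair_graph G \<and> regular_graph (2 * k) G \<and>
                     ordered_hamiltonian (2 * k + 1) G)"
proof -
  \<comment> \<open>The lengths \<open>2 * j + 4\<close> run through all even numbers from 4 on. The
    number of vertices alone separates the graphs, both as values and up to isomorphism.\<close>
  let ?G = "\<lambda>j. blowup (2 * j + 4) k"
  have card: "card (pverts (?G j)) = (2 * j + 4) * k" for j
    by (simp add: blowup_def)
  have inj: "i = j" if "card (pverts (?G i)) = card (pverts (?G j))" for i j
    using that assms unfolding card by simp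
  have "infinite (range ?G)"
  proof (rule range_inj_infinite, rule injI)
    show "i = j" if "?G i = ?G j" for i j
      by (rule inj) (simp only: that)
  qed
  moreover have "pairwise (\<lambda>G H. \<not> digraph_iso (with_proj G) (with_proj H)) (range ?G)"
  proof (rule pairwiseI, clarify)
    fix i j assume "?G i \<noteq> ?G j" "digraph_iso (with_proj (?G i)) (with_proj (?G j))"
    then show False
      using inj[of i j] digraph_iso_card_verts[of "with_proj (?G i)" "with_proj (?G j)"]
      by (simp only: with_proj_simps) blast
  qed
  moreover have "\<forall>G \<in> range ?G. pair_graph G \<and> regular_graph (2 * k) G \<and>
      ordered_hamiltonian (2 * k + 1) G"
    using assms pair_graph_blowup regular_blowup ordered_hamiltonian_blowup by simp
  ultimately show ?thesis by blast
qed

end
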